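(* Let $S$ be a periodic inverse semigroup. Then $S$ is a HS if and only if it is a HIS.
   Context: All structures are countable. For an inverse semigroup $S$: $S$ is a HIS if every isomorphism between finitely generated inverse subsemigroups of $S$ extends to an automorphism of $S$; $S$ is a HS (homogeneous semigroup) if every isomorphism between finitely generated subsemigroups of $S$ extends to an automorphism of $S$. The order of $a\in S$ is the cardinality of the inverse subsemigroup generated by $a$, and $S$ is periodic if every element has finite order. *)

theory Defs
  imports Complex_Main "HOL-Library.Countable_Set"
begin

definition semigroup_iso :: "('a \<Rightarrow> 'a \<Rightarrow> 'a) \<Rightarrow> ('a \<Rightarrow> 'a) \<Rightarrow> 'a set \<Rightarrow> 'a set \<Rightarrow> bool" where
  "semigroup_iso mult f A B \<longleftrightarrow>
     bij_betw f A B \<and> (\<forall>x\<in>A. \<forall>y\<in>A. f (mult x y) = mult (f x) (f y))"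

text \<open>
  The empty carrier, and the empty set as a (finitely generated) subsemigroup, are admitted.
  This does not affect the homogeneity notions below: the only isomorphism between empty
  subsemigroups is the empty map, which is extended by the identity.
\<close>

locale inverse_semigroup =
  fixes S :: "'a set" and mult :: "'a \<Rightarrow> 'a \<Rightarrow> 'a" (infixl "\<cdot>" 70)
  assumes mult_closed: "x \<in> S \<Longrightarrow> y \<in> S \<Longrightarrow> x \<cdot> y \<in> S"
    and mult_assoc: "x \<in> S \<Longrightarrow> y \<in> S \<Longrightarrow> z \<in> S \<Longrightarrow> (x \<cdot> y) \<cdot> z = x \<cdot> (y \<cdot> z)"
    and ex1_inverse: "x \<in> S \<Longrightarrow> \<exists>!y. y \<in> S \<and> x \<cdot> y \<cdot> x = x \<and> y \<cdot> x \<cdot> y = y"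
begin

definition inverse_of :: "'a \<Rightarrow> 'a" where
  "inverse_of x = (THE y. y \<in> S \<and> x \<cdot> y \<cdot> x = x \<and> y \<cdot> x \<cdot> y = y)"

definition subsemigroup :: "'a set \<Rightarrow> bool" where
  "subsemigroup T \<longleftrightarrow> T \<subseteq> S \<and> (\<forall>x\<in>T. \<forall>y\<in>T. x \<cdot> y \<in> T)"

definition inverse_subsemigroup :: "'a set \<Rightarrow> bool" where
  "inverse_subsemigroup T \<longleftrightarrow> subsemigroup T \<and> (\<forall>x\<in>T. inverse_of x \<in> T)"

definition fg_subsemigroup :: "'a set \<Rightarrow> bool" where
  "fg_subsemigroup T \<longleftrightarrow> (\<exists>X. finite X \<and> X \<subseteq> S \<and> T = subsemigroup hull X)"

definition fg_inverse_subsemigroup :: "'a set \<Rightarrow> bool" where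
  "fg_inverse_subsemigroup T \<longleftrightarrow> (\<exists>X. finite X \<and> X \<subseteq> S \<and> T = inverse_subsemigroup hull X)"

definition extends_to_automorphism :: "('a \<Rightarrow> 'a) \<Rightarrow> 'a set \<Rightarrow> bool" where
  "extends_to_automorphism f A \<longleftrightarrow> (\<exists>g. semigroup_iso mult g S S \<and> (\<forall>x\<in>A. g x = f x))"

definition HS :: bool where
  "HS \<longleftrightarrow> (\<forall>A B f. fg_subsemigroup A \<and> fg_subsemigroup B \<and> semigroup_iso mult f A B
             \<longrightarrow> extends_to_automorphism f A)"

text \<open>
  A semigroup isomorphism between inverse semigroups automatically preserves inverses, so
  \<^const>\<open>semigroup_iso\<close> is also the notion of isomorphism of inverse semigroups.
\<close>

definition HIS :: bool where
  "HIS \<longleftrightarrow> (\<forall>A B f. fg_inverse_subsemigroup A \<and> fg_inverse_subsemigroup B \<and> semigroup_iso mult f A B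
              \<longrightarrow> extends_to_automorphism f A)"

text \<open>The order of \<open>a\<close> is the cardinality of the inverse subsemigroup generated by \<open>a\<close>.\<close>

definition periodic :: bool where
  "periodic \<longleftrightarrow> (\<forall>a\<in>S. finite (inverse_subsemigroup hull {a}))"

end

end

theory Submission
  imports Defs
begin

text \<open>
  The point is that a periodic HIS is a Clifford semigroup: \<open>x x\<inverse> = x\<inverse> x\<close> for all \<open>x\<close>.
  By homogeneity the automorphism group acts transitively on the pairs of idempotents of a given
  order type. Let \<open>e = x x\<inverse>\<close> and \<open>f = x\<inverse> x\<close> be distinct; by periodicity they are
  incomparable. If some idempotent \<open>r < e\<close> is not below \<open>f\<close>, then an automorphism maps \<open>(e, f)\<close>
  to \<open>(f, r)\<close> and \<open>x\<close> to some \<open>y\<close>, and \<open>x y\<close> generates a bicyclic semigroup, which is infinite.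
  So \<open>e f\<close> is the greatest idempotent strictly below \<open>e\<close>; being thus fixed by every
  automorphism that fixes \<open>e\<close>, it is the only idempotent below \<open>e\<close>. But transitivity provides
  an idempotent strictly below \<open>e f\<close>.

  In a periodic Clifford semigroup \<open>x\<inverse>\<close> is a power of \<open>x\<close>, so subsemigroups and inverse
  subsemigroups coincide. Conversely, every finitely generated inverse subsemigroup is finitely
  generated as a semigroup, so a HS is always a HIS.
\<close>

context inverse_semigroup
begin

section \<open>Inverses and commuting idempotents\<close>

lemma
  assumes "x \<in> S"
  shows inverse_closed: "inverse_of x \<in> S"
    and mult_inverse_mult: "x \<cdot> inverse_of x \<cdot> x = x"
    and inverse_mult_inverse: "inverse_of x \<cdot> x \<cdot> inverse_of x = inverse_of x"
  using theI'[OF ex1_inverse[OF assms]] unfolding inverse_of_def by auto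

lemma inverse_unique:
  assumes "x \<in> S" "y \<in> S" "x \<cdot> y \<cdot> x = x" "y \<cdot> x \<cdot> y = y"
  shows "inverse_of x = y"
  unfolding inverse_of_def using assms by (intro the1_equality[OF ex1_inverse]) auto

lemma inverse_inverse: "x \<in> S \<Longrightarrow> inverse_of (inverse_of x) = x"
  by (simp add: inverse_unique inverse_closed mult_inverse_mult inverse_mult_inverse)

lemma inverse_idem: "e \<in> S \<Longrightarrow> e \<cdot> e = e \<Longrightarrow> inverse_of e = e"
  by (simp add: inverse_unique)

lemma idem_mult_inverse: "x \<in> S \<Longrightarrow> (x \<cdot> inverse_of x) \<cdot> (x \<cdot> inverse_of x) = x \<cdot> inverse_of x"
  using mult_inverse_mult[of x] inverse_closed[of x]
  by (simp add: mult_closed mult_assoc[symmetric])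

text \<open>With \<open>x\<close> the inverse of \<open>e \<cdot> f\<close>, the element
  \<open>f \<cdot> x \<cdot> e\<close> is an inverse of \<open>e \<cdot> f\<close> as well, so it
  equals \<open>x\<close>; this form makes \<open>x\<close> idempotent. Idempotents are their own
  inverses, hence \<open>e \<cdot> f = x\<close>.\<close>

lemma idem_mult_idem:
  assumes "e \<in> S" "f \<in> S" "e \<cdot> e = e" "f \<cdot> f = f"
  shows "(e \<cdot> f) \<cdot> (e \<cdot> f) = e \<cdot> f"
proof -
  define x where "x = inverse_of (e \<cdot> f)"
  note ms = mult_closed mult_assoc
  have ef: "e \<cdot> f \<in> S" using assms mult_closed by simp
  have x: "x \<in> S" "e \<cdot> f \<cdot> x \<cdot> (e \<cdot> f) = e \<cdot> f" "x \<cdot> (e \<cdot> f) \<cdot> x = x"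
    using inverse_closed mult_inverse_mult inverse_mult_inverse ef unfolding x_def by auto
  have ee: "e \<cdot> (e \<cdot> u) = e \<cdot> u" and ff: "f \<cdot> (f \<cdot> u) = f \<cdot> u" if "u \<in> S" for u
    using that assms mult_assoc by metis+
  have x2: "x \<cdot> (e \<cdot> (f \<cdot> x)) = x" using x assms by (simp add: ms)
  have x3: "x \<cdot> (e \<cdot> (f \<cdot> (x \<cdot> e))) = x \<cdot> e"
    using arg_cong[OF x2, of "\<lambda>u. u \<cdot> e"] x(1) assms by (simp add: ms)
  have "inverse_of (e \<cdot> f) = f \<cdot> x \<cdot> e"
  proof (rule inverse_unique)
    show "e \<cdot> f \<cdot> (f \<cdot> x \<cdot> e) \<cdot> (e \<cdot> f) = e \<cdot> f" 
      using x assms ee ff by (simp add: ms)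
    show "f \<cdot> x \<cdot> e \<cdot> (e \<cdot> f) \<cdot> (f \<cdot> x \<cdot> e) = f \<cdot> x \<cdot> e"
      using x(1) x3 assms ee ff by (simp add: ms)
  qed (use ef x assms mult_closed in auto)
  then have xe: "x = f \<cdot> (x \<cdot> e)" unfolding x_def using x(1) assms by (simp add: ms x_def)
  have "x \<cdot> x = (f \<cdot> (x \<cdot> e)) \<cdot> (f \<cdot> (x \<cdot> e))" using xe by simp
  also have "\<dots> = f \<cdot> (x \<cdot> e)" using x(1) x3 assms by (simp add: ms)
  finally have xx: "x \<cdot> x = x" using xe by simp
  then have "inverse_of x = x" using x(1) inverse_idem by simp
  then have "e \<cdot> f = x" unfolding x_def using inverse_inverse[OF ef] by simp
  then show ?thesis using xx by simp
qed

text \<open>Both products are idempotent, which makes \<open>f \<cdot> e\<close> an inverse of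
  \<open>e \<cdot> f\<close>; but an idempotent is its own inverse.\<close>

lemma idem_commute:
  assumes "e \<in> S" "f \<in> S" "e \<cdot> e = e" "f \<cdot> f = f"
  shows "e \<cdot> f = f \<cdot> e"
proof -
  have S: "e \<cdot> f \<in> S" "f \<cdot> e \<in> S" using assms mult_closed by auto
  have ee: "e \<cdot> (e \<cdot> u) = e \<cdot> u" and ff: "f \<cdot> (f \<cdot> u) = f \<cdot> u" if "u \<in> S" for u
    using that assms mult_assoc by metis+
  have "inverse_of (e \<cdot> f) = f \<cdot> e"
    using idem_mult_idem[OF assms] idem_mult_idem[of f e] assms ee ff S
    by (intro inverse_unique) (simp_all add: mult_closed mult_assoc)
  moreover have "inverse_of (e \<cdot> f) = e \<cdot> f"
    using S(1) idem_mult_idem[OF assms] inverse_idem by simp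
  ultimately show ?thesis by simp
qed

lemma automorphism_inverse:
  assumes "semigroup_iso (\<cdot>) \<phi> S S" "x \<in> S"
  shows "\<phi> (inverse_of x) = inverse_of (\<phi> x)"
proof -
  have S: "\<phi> u \<in> S" if "u \<in> S" for u
    using assms(1) that unfolding semigroup_iso_def bij_betw_def by blast
  have hom: "\<phi> (u \<cdot> v) = \<phi> u \<cdot> \<phi> v" if "u \<in> S" "v \<in> S" for u v
    using assms(1) that unfolding semigroup_iso_def by blast
  show ?thesis
    using assms(2) S inverse_closed mult_inverse_mult[OF assms(2)] inverse_mult_inverse[OF assms(2)]
    by (intro inverse_unique[symmetric]) (simp_all add: hom[symmetric] mult_closed)
qed

section \<open>Generated subsemigroups and powers of an element\<close>

lemma subsemigroup_hull:
  assumes "X \<subseteq> S"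
  shows "subsemigroup (subsemigroup hull X)"
proof -
  have "subsemigroup S" using mult_closed unfolding subsemigroup_def by simp
  then show ?thesis
    using assms unfolding hull_def subsemigroup_def by auto
qed

lemma inverse_subsemigroup_hull:
  assumes "X \<subseteq> S"
  shows "inverse_subsemigroup (inverse_subsemigroup hull X)"
proof -
  have "inverse_subsemigroup S"
    using mult_closed inverse_closed unfolding inverse_subsemigroup_def subsemigroup_def by simp
  then show ?thesis
    using assms unfolding hull_def inverse_subsemigroup_def subsemigroup_def by auto
qed

lemma fg_inverse_subsemigroup_finite:
  assumes "inverse_subsemigroup T" "finite T"
  shows "fg_inverse_subsemigroup T"
  unfolding fg_inverse_subsemigroup_def
  using assms hull_same[of inverse_subsemigroup T]
  by (metis inverse_subsemigroup_def subsemigroup_def)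

text \<open>Hypothesis \<open>xe\<close> means x^-1 x \<le> x x^-1 in the order of idempotents; a
  strict inequality would give a bicyclic semigroup. It allows a last factor \<open>x\<close> to be
  cancelled from powers, so two coinciding powers make x x^-1, and then x^-1, a power of
  \<open>x\<close>.\<close>

lemma inverse_mem_subsemigroup_hull:
  assumes x: "x \<in> S" and fin: "finite (inverse_subsemigroup hull {x})"
    and xe: "x \<cdot> (x \<cdot> inverse_of x) = x"
  shows "inverse_of x \<in> subsemigroup hull {x}" and "inverse_of x \<cdot> x = x \<cdot> inverse_of x"
proof -
  \<comment> \<open>\<open>pow n\<close> is the power with exponent \<open>n + 1\<close>\<close>
  define pow where "pow = rec_nat x (\<lambda>_ u. u \<cdot> x)"
  have pow0: "pow 0 = x" and powS: "pow (Suc n) = pow n \<cdot> x" for n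
    unfolding pow_def by simp_all
  let ?y = "inverse_of x"
  note y = inverse_closed[OF x]
  have pow_hull: "pow n \<in> subsemigroup hull {x}" for n
    using subsemigroup_hull[of "{x}"] hull_inc[of x "{x}" subsemigroup] x
    by (induction n) (auto simp: pow0 powS subsemigroup_def)
  have pow_S: "pow n \<in> S" for n
    using x by (induction n) (auto simp: pow0 powS mult_closed)
  have pow_e: "pow n \<cdot> (x \<cdot> ?y) = pow n" for n
    using x y xe pow_S by (cases n) (auto simp: pow0 powS mult_closed mult_assoc)
  have pow_comm: "pow n \<cdot> x = x \<cdot> pow n" for n
    using x pow_S by (induction n) (simp_all add: pow0 powS, metis mult_assoc)
  have pow_inv: "pow (Suc n) \<cdot> ?y = pow n" for n
    using x y pow_S pow_e by (simp add: powS mult_assoc)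
  have "subsemigroup hull {x} \<subseteq> inverse_subsemigroup hull {x}"
    using x inverse_subsemigroup_hull[of "{x}"]
    by (intro hull_minimal hull_subset) (simp add: inverse_subsemigroup_def)
  then have "finite (range pow)"
    using fin pow_hull by (meson finite_subset image_subsetI subset_iff)
  then have "\<not> inj pow"
    using range_inj_infinite by blast
  then obtain i j where "i < j" "pow i = pow j"
    unfolding inj_def by (metis nat_neq_iff)
  \<comment> \<open>Cancelling last factors \<open>x\<close> on both sides brings the smaller power
    down to \<open>pow 0\<close>.\<close>
  then have "\<exists>k. pow 0 = pow (Suc k)"
  proof (induction i arbitrary: j)
    case 0
    then show ?case by (metis gr0_implies_Suc)
  next
    case (Suc i)
    obtain j' where j': "j = Suc j'"
      using Suc.prems(1) by (metis Suc_lessE)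
    then show ?case
      using Suc pow_inv by (metis Suc_less_eq)
  qed
  then obtain k where "x = pow (Suc k)" using pow0 by auto
  then have e: "x \<cdot> ?y = pow k" using pow_inv by metis
  \<comment> \<open>Since \<open>pow 0\<close> is \<open>x\<close> itself, \<open>k = 0\<close>
    means that \<open>x\<close> is idempotent. Otherwise one more factor x^-1 can be applied, and x
    x^-1 x^-1 is again an inverse of \<open>x\<close>.\<close>
  have "\<exists>m. ?y = pow m"
  proof (cases k)
    case 0
    then have "x \<cdot> x = x" using e xe pow0 by simp
    then have "?y = pow 0" using inverse_idem x pow0 by simp
    then show ?thesis by blast
  next
    case (Suc m)
    have m: "pow m = (x \<cdot> ?y) \<cdot> ?y" using e pow_inv Suc by simp
    have ex: "x \<cdot> (x \<cdot> (?y \<cdot> u)) = x \<cdot> u" if "u \<in> S" for u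
      using arg_cong[OF xe, of "\<lambda>v. v \<cdot> u"] x y that by (simp add: mult_closed mult_assoc)
    have "?y = (x \<cdot> ?y) \<cdot> ?y"
      using x y ex mult_inverse_mult[OF x] inverse_mult_inverse[OF x]
      by (intro inverse_unique) (simp_all add: mult_closed mult_assoc)
    then show ?thesis using m by metis
  qed
  then show "?y \<in> subsemigroup hull {x}" "?y \<cdot> x = x \<cdot> ?y"
    using pow_hull pow_comm by metis+
qed

section \<open>Homogeneity and the Clifford property\<close>

lemma HIS_idem_pairs:
  assumes HIS
    and S: "e \<in> S" "f \<in> S" "e' \<in> S" "f' \<in> S"
    and idem: "e \<cdot> e = e" "f \<cdot> f = f" "e' \<cdot> e' = e'" "f' \<cdot> f' = f'"
    and type: "e \<cdot> f = e \<longleftrightarrow> e' \<cdot> f' = e'" "e \<cdot> f = f \<longleftrightarrow> e' \<cdot> f' = f'"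
  obtains \<phi> where "semigroup_iso (\<cdot>) \<phi> S S" "\<phi> e = e'" "\<phi> f = f'"
proof -
  \<comment> \<open>The conditions \<open>type\<close> say that both pairs satisfy the same order
    relations. They make \<open>g\<close> take the right values also when \<open>e\<close>,
    \<open>f\<close> and \<open>e \<cdot> f\<close> are not distinct.\<close>
  define g where "g u = (if u = e then e' else if u = f then f' else e' \<cdot> f')" for u
  have inv_sub: "inverse_subsemigroup {a, b, a \<cdot> b}"
      and tab: "b \<cdot> a = a \<cdot> b" "a \<cdot> (a \<cdot> b) = a \<cdot> b" "b \<cdot> (a \<cdot> b) = a \<cdot> b"
        "(a \<cdot> b) \<cdot> a = a \<cdot> b" "(a \<cdot> b) \<cdot> b = a \<cdot> b" "(a \<cdot> b) \<cdot> (a \<cdot> b) = a \<cdot> b"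
    if "a \<in> S" "b \<in> S" "a \<cdot> a = a" "b \<cdot> b = b" for a b
  proof -
    show tab: "b \<cdot> a = a \<cdot> b" "a \<cdot> (a \<cdot> b) = a \<cdot> b" "b \<cdot> (a \<cdot> b) = a \<cdot> b"
        "(a \<cdot> b) \<cdot> a = a \<cdot> b" "(a \<cdot> b) \<cdot> b = a \<cdot> b" "(a \<cdot> b) \<cdot> (a \<cdot> b) = a \<cdot> b"
      using that idem_commute[of a b] idem_mult_idem[of a b] mult_assoc by metis+
    show "inverse_subsemigroup {a, b, a \<cdot> b}"
      unfolding inverse_subsemigroup_def subsemigroup_def
      using that tab inverse_idem mult_closed by auto
  qed
  note tab1 = tab[OF S(1,2) idem(1,2)] and tab2 = tab[OF S(3,4) idem(3,4)]
  have eq: "e = f \<longleftrightarrow> e' = f'" using type idem tab1 tab2 by metis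
  have g: "g e = e'" "g f = f'" "g (e \<cdot> f) = e' \<cdot> f'"
    using eq type unfolding g_def by auto
  have "semigroup_iso (\<cdot>) g {e, f, e \<cdot> f} {e', f', e' \<cdot> f'}"
    unfolding semigroup_iso_def
  proof
    have "inj_on g {e, f, e \<cdot> f}"
      unfolding inj_on_def using g eq type by auto
    then show "bij_betw g {e, f, e \<cdot> f} {e', f', e' \<cdot> f'}"
      unfolding bij_betw_def using g by simp
    show "\<forall>x\<in>{e, f, e \<cdot> f}. \<forall>y\<in>{e, f, e \<cdot> f}. g (x \<cdot> y) = g x \<cdot> g y"
      using g tab1 tab2 idem by simp
  qed
  moreover have "fg_inverse_subsemigroup {e, f, e \<cdot> f}" "fg_inverse_subsemigroup {e', f', e' \<cdot> f'}"
    using inv_sub S idem by (simp_all add: fg_inverse_subsemigroup_finite)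
  ultimately have "extends_to_automorphism g {e, f, e \<cdot> f}"
    using \<open>HIS\<close> unfolding HIS_def by blast
  then show thesis
    using g that unfolding extends_to_automorphism_def by auto
qed

lemma HIS_periodic_Clifford:
  assumes HIS periodic and x: "x \<in> S"
  shows "x \<cdot> inverse_of x = inverse_of x \<cdot> x"
proof (rule ccontr)
  define x' where "x' = inverse_of x"
  define e where "e = x \<cdot> x'"
  define f where "f = x' \<cdot> x"
  assume "\<not> ?thesis"
  then have neq: "e \<noteq> f" unfolding e_def f_def x'_def .
  have x': "x' \<in> S" unfolding x'_def using inverse_closed[OF x] .
  have xx'x: "x \<cdot> x' \<cdot> x = x" "x' \<cdot> x \<cdot> x' = x'"
    unfolding x'_def using mult_inverse_mult inverse_mult_inverse x by auto
  have inv_x': "inverse_of x' = x" unfolding x'_def using inverse_inverse[OF x] .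
  have S: "e \<in> S" "f \<in> S" unfolding e_def f_def using x x' mult_closed by auto
  have idem: "e \<cdot> e = e" "f \<cdot> f = f"
    unfolding e_def f_def
    using idem_mult_inverse[OF x] idem_mult_inverse[OF x'] inv_x' x'_def by auto
  have ef_comm: "e \<cdot> f = f \<cdot> e" using idem_commute S idem by simp
  \<comment> \<open>Periodicity enters only here: if z^-1 z \<le> z z^-1, the two are equal.\<close>
  have commutes: "inverse_of z \<cdot> z = z \<cdot> inverse_of z"
    if "z \<in> S" "z \<cdot> (z \<cdot> inverse_of z) = z" for z
    using inverse_mem_subsemigroup_hull(2)[of z] that \<open>periodic\<close> unfolding periodic_def by blast
  have xf: "x \<cdot> f = x" using xx'x x x' unfolding f_def by (simp add: mult_assoc)
  have x'e: "x' \<cdot> e = x'" using xx'x x x' unfolding e_def by (simp add: mult_assoc)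
  \<comment> \<open>From f \<le> e follows \<open>x \<cdot> e = x\<close>. The reverse relation is
    excluded in the same way with \<open>x'\<close>, for which \<open>e\<close> and \<open>f\<close>
    change places.\<close>
  have not_f_le_e: "f \<cdot> e \<noteq> f"
  proof
    assume "f \<cdot> e = f"
    then have "x \<cdot> e = x" using xf x S mult_assoc by metis
    then show False using commutes[OF x] neq unfolding e_def f_def x'_def by simp
  qed
  have not_e_le_f: "e \<cdot> f \<noteq> e"
  proof
    assume "e \<cdot> f = e"
    then have "x' \<cdot> f = x'" using x'e x' S mult_assoc by metis
    then show False using commutes[OF x'] neq inv_x' unfolding e_def f_def by simp
  qed
  \<comment> \<open>Otherwise \<open>f\<close> and \<open>r\<close> are incomparable, since f \<le>
    r would give f \<le> e. Thus \<open>(e, f)\<close> and \<open>(f, r)\<close> have the same order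
    type.\<close>
  have below: "r \<cdot> f = r" if r: "r \<in> S" "r \<cdot> r = r" "r \<cdot> e = r" "r \<noteq> e" for r
  proof (rule ccontr)
    assume "r \<cdot> f \<noteq> r"
    then have "f \<cdot> r \<noteq> r" using idem_commute S idem r by simp
    moreover have "f \<cdot> r \<noteq> f"
      using r(1,3) S not_f_le_e mult_assoc by metis
    ultimately obtain \<phi> where \<phi>: "semigroup_iso (\<cdot>) \<phi> S S" "\<phi> e = f" "\<phi> f = r"
      using HIS_idem_pairs[OF \<open>HIS\<close>, of e f f r] S idem r not_e_le_f not_f_le_e ef_comm
      by metis
    \<comment> \<open>Here y y^-1 = f and y^-1 y = r, so \<open>x\<close> and \<open>y\<close>
      compose without loss: z = x y has z z^-1 = e and z^-1 z = r. As r \<le> e,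
      \<open>commutes\<close> forces \<open>r = e\<close>.\<close>
    define y where "y = \<phi> x"
    define y' where "y' = \<phi> x'"
    have y: "y \<in> S" "y' \<in> S"
      using \<phi>(1) x x' unfolding y_def y'_def semigroup_iso_def bij_betw_def by auto
    have y': "y' = inverse_of y"
      unfolding y_def y'_def x'_def using automorphism_inverse[OF \<phi>(1) x] .
    have yy': "y \<cdot> y' = f" "y' \<cdot> y = r"
      using \<phi> x x' unfolding y_def y'_def e_def f_def semigroup_iso_def by metis+
    have yr: "y \<cdot> r = y" "f \<cdot> y = y" "r \<cdot> y' = y'" "y' \<cdot> f = y'"
      using yy' y mult_inverse_mult[OF y(1)] inverse_mult_inverse[OF y(1)] mult_assoc
      unfolding y' by metis+
    have ex: "e \<cdot> x = x" using xx'x unfolding e_def by simp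
    have fx': "f \<cdot> x' = x'" using xx'x unfolding f_def by simp
    have zS: "x \<cdot> y \<in> S" "y' \<cdot> x' \<in> S" using x x' y mult_closed by auto
    have "(x \<cdot> y) \<cdot> (y' \<cdot> x') = x \<cdot> ((y \<cdot> y') \<cdot> x')"
      using x x' y by (simp add: mult_closed mult_assoc)
    then have zz': "(x \<cdot> y) \<cdot> (y' \<cdot> x') = e"
      using yy' fx' e_def by simp
    have "(y' \<cdot> x') \<cdot> (x \<cdot> y) = y' \<cdot> ((x' \<cdot> x) \<cdot> y)"
      using x x' y by (simp add: mult_closed mult_assoc)
    then have z'z: "(y' \<cdot> x') \<cdot> (x \<cdot> y) = r"
      using yy' yr f_def by simp
    have inv_z: "inverse_of (x \<cdot> y) = y' \<cdot> x'"
    proof (rule inverse_unique[OF zS])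
      show "x \<cdot> y \<cdot> (y' \<cdot> x') \<cdot> (x \<cdot> y) = x \<cdot> y"
        unfolding zz' using ex S x y mult_assoc by metis
      show "y' \<cdot> x' \<cdot> (x \<cdot> y) \<cdot> (y' \<cdot> x') = y' \<cdot> x'"
        unfolding z'z using yr r(1) x' y mult_assoc by metis
    qed
    have "(x \<cdot> y) \<cdot> e = x \<cdot> y"
      using yr(1) r(1,3) S x y mult_assoc mult_closed by metis
    then have "r = e"
      using commutes[OF zS(1)] unfolding inv_z zz' z'z by simp
    then show False using r(4) by simp
  qed
  \<comment> \<open>By \<open>below\<close>, this is the greatest idempotent strictly below
    \<open>e\<close>.\<close>
  define h where "h = e \<cdot> f"
  have h: "h \<in> S" "h \<cdot> h = h" "h \<cdot> e = h" "e \<cdot> h = h" "h \<noteq> e"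
    using S idem ef_comm idem_mult_idem[of e f] not_e_le_f mult_closed mult_assoc
    unfolding h_def by metis+
  have below_h: "r \<cdot> h = r" if "r \<in> S" "r \<cdot> r = r" "r \<cdot> e = r" "r \<noteq> e" for r
    using below[OF that] that S mult_assoc unfolding h_def by metis
  \<comment> \<open>Pairs with equal entries give transitivity on single idempotents. Applying the
    automorphism to h < e yields h' < h.\<close>
  obtain \<phi> where \<phi>: "semigroup_iso (\<cdot>) \<phi> S S" "\<phi> e = h"
    using HIS_idem_pairs[OF \<open>HIS\<close>, of e e h h] S idem h by metis
  define h' where "h' = \<phi> h"
  have h'S: "h' \<in> S"
    using \<phi>(1) h(1) unfolding h'_def semigroup_iso_def bij_betw_def by auto
  have h'_idem: "h' \<cdot> h' = h'" and h'h: "h' \<cdot> h = h'"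
    using \<phi> h S unfolding h'_def semigroup_iso_def by metis+
  have h'_ne: "h' \<noteq> h"
    using \<phi> h S unfolding h'_def semigroup_iso_def bij_betw_def inj_on_def by metis
  have h'e: "h' \<cdot> e = h'"
    using h'h h h'S S mult_assoc by metis
  have h'_ne_e: "h' \<noteq> e"
    using h'h h by metis
  \<comment> \<open>Both \<open>h\<close> and \<open>h'\<close> lie strictly below \<open>e\<close>,
    so the pairs \<open>(h, e)\<close> and \<open>(h', e)\<close> have the same order type.\<close>
  obtain \<psi> where \<psi>: "semigroup_iso (\<cdot>) \<psi> S S" "\<psi> h = h'" "\<psi> e = e"
    using HIS_idem_pairs[OF \<open>HIS\<close>, of h e h' e] S idem h h'S h'_idem h'e h'_ne_e by metis
  have hom: "\<psi> (u \<cdot> v) = \<psi> u \<cdot> \<psi> v" if "u \<in> S" "v \<in> S" for u v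
    using \<psi>(1) that unfolding semigroup_iso_def by blast
  have inj: "u = v" if "\<psi> u = \<psi> v" "u \<in> S" "v \<in> S" for u v
    using \<psi>(1) that unfolding semigroup_iso_def bij_betw_def inj_on_def by blast
  have "h \<in> \<psi> ` S"
    using \<psi>(1) h(1) unfolding semigroup_iso_def bij_betw_def by simp
  \<comment> \<open>As \<psi> fixes \<open>e\<close>, this preimage of \<open>h\<close> lies
    strictly below \<open>e\<close>, hence below \<open>h\<close>. Applying \<psi> gives h \<le> h',
    against h' < h.\<close>
  then obtain r where r: "r \<in> S" "\<psi> r = h" by blast
  have "\<psi> (r \<cdot> r) = \<psi> r" "\<psi> (r \<cdot> e) = \<psi> r"
    using hom[OF r(1) r(1)] hom[OF r(1) S(1)] r(2) h(2,3) \<psi>(3) by simp_all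
  then have "r \<cdot> r = r" "r \<cdot> e = r"
    using inj mult_closed r(1) S(1) by blast+
  moreover have "r \<noteq> e" using r \<psi>(3) h by auto
  ultimately have "r \<cdot> h = r" using below_h r(1) by blast
  then have "h \<cdot> h' = h" using hom[OF r(1) h(1)] r(2) \<psi>(2) by simp
  then show False
    using h'h h'_ne idem_commute[OF h(1) h'S h(2) h'_idem] by simp
qed

section \<open>Finite generation with and without inverses\<close>

lemma inverse_hull_eq_hull:
  assumes "X \<subseteq> S"
  shows "inverse_subsemigroup hull X = subsemigroup hull (X \<union> inverse_of ` X)"
proof
  have XS: "X \<union> inverse_of ` X \<subseteq> S" using assms inverse_closed by auto
  let ?T = "subsemigroup hull (X \<union> inverse_of ` X)"
  note T = subsemigroup_hull[OF XS]
  have TS: "?T \<subseteq> S" using T unfolding subsemigroup_def by simp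
  \<comment> \<open>The elements of \<open>?T\<close> whose inverse lies in \<open>?T\<close> form a subsemigroup.\<close>
  let ?U = "{u \<in> ?T. inverse_of u \<in> ?T}"
  \<comment> \<open>The idempotents v v^-1 and u^-1 u meet in the middle of the products and
    commute.\<close>
  have inv_mult: "inverse_of (u \<cdot> v) = inverse_of v \<cdot> inverse_of u" if uv: "u \<in> S" "v \<in> S" for u v
  proof -
    let ?u = "inverse_of u" and ?v = "inverse_of v"
    have S: "?u \<in> S" "?v \<in> S" using uv inverse_closed by auto
    have comm: "(v \<cdot> ?v) \<cdot> (?u \<cdot> u) = (?u \<cdot> u) \<cdot> (v \<cdot> ?v)"
      using idem_mult_inverse[OF uv(2)] idem_mult_inverse[OF S(1)] inverse_inverse[OF uv(1)] uv S
      by (intro idem_commute) (simp_all add: mult_closed)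
    have "(u \<cdot> v) \<cdot> (?v \<cdot> ?u) \<cdot> (u \<cdot> v) = u \<cdot> ((v \<cdot> ?v) \<cdot> (?u \<cdot> u)) \<cdot> v"
      using uv S by (simp add: mult_closed mult_assoc)
    also have "\<dots> = (u \<cdot> ?u \<cdot> u) \<cdot> (v \<cdot> ?v \<cdot> v)"
      unfolding comm using uv S by (simp add: mult_closed mult_assoc)
    finally have 1: "(u \<cdot> v) \<cdot> (?v \<cdot> ?u) \<cdot> (u \<cdot> v) = u \<cdot> v"
      using mult_inverse_mult uv by simp
    have "(?v \<cdot> ?u) \<cdot> (u \<cdot> v) \<cdot> (?v \<cdot> ?u) = ?v \<cdot> ((?u \<cdot> u) \<cdot> (v \<cdot> ?v)) \<cdot> ?u"
      using uv S by (simp add: mult_closed mult_assoc)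
    also have "\<dots> = (?v \<cdot> v \<cdot> ?v) \<cdot> (?u \<cdot> u \<cdot> ?u)"
      unfolding comm[symmetric] using uv S by (simp add: mult_closed mult_assoc)
    finally have 2: "(?v \<cdot> ?u) \<cdot> (u \<cdot> v) \<cdot> (?v \<cdot> ?u) = ?v \<cdot> ?u"
      using inverse_mult_inverse uv by simp
    show ?thesis using 1 2 uv S by (intro inverse_unique) (simp_all add: mult_closed)
  qed
  have "subsemigroup ?U"
    using T TS inv_mult unfolding subsemigroup_def by (auto simp: subset_iff)
  moreover have "X \<union> inverse_of ` X \<subseteq> ?U"
    using hull_subset[of "X \<union> inverse_of ` X" subsemigroup] assms inverse_inverse
    by (auto simp: subset_iff)
  ultimately have "?T \<subseteq> ?U" by (intro hull_minimal)
  then have "inverse_subsemigroup ?T"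
    using T unfolding inverse_subsemigroup_def by auto
  then show "inverse_subsemigroup hull X \<subseteq> ?T"
    using hull_subset[of "X \<union> inverse_of ` X" subsemigroup] by (intro hull_minimal) auto
  have "inverse_subsemigroup (inverse_subsemigroup hull X)"
    using inverse_subsemigroup_hull[OF assms] .
  then show "?T \<subseteq> inverse_subsemigroup hull X"
    using hull_subset[of X inverse_subsemigroup] unfolding inverse_subsemigroup_def
    by (intro hull_minimal) auto
qed

lemma HS_imp_HIS:
  assumes HS
  shows HIS
proof -
  have "fg_subsemigroup A" if "fg_inverse_subsemigroup A" for A
  proof -
    obtain X where X: "finite X" "X \<subseteq> S" "A = inverse_subsemigroup hull X"
      using \<open>fg_inverse_subsemigroup A\<close> unfolding fg_inverse_subsemigroup_def by blast
    then have "finite (X \<union> inverse_of ` X)" "X \<union> inverse_of ` X \<subseteq> S"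
      using inverse_closed by auto
    then show ?thesis
      using inverse_hull_eq_hull[OF X(2)] X(3) unfolding fg_subsemigroup_def by blast
  qed
  then show ?thesis using assms unfolding HS_def HIS_def by blast
qed

lemma HIS_periodic_imp_HS:
  assumes HIS periodic
  shows HS
proof -
  have inv: "inverse_of x \<in> subsemigroup hull {x}" if "x \<in> S" for x
  proof (rule inverse_mem_subsemigroup_hull(1)[OF that])
    show "finite (inverse_subsemigroup hull {x})"
      using \<open>periodic\<close> that unfolding periodic_def by blast
    show "x \<cdot> (x \<cdot> inverse_of x) = x"
      using HIS_periodic_Clifford[OF assms that] mult_inverse_mult that inverse_closed mult_assoc
      by metis
  qed
  have "fg_inverse_subsemigroup A" if "fg_subsemigroup A" for A
  proof -
    obtain X where X: "finite X" "X \<subseteq> S" "A = subsemigroup hull X"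
      using \<open>fg_subsemigroup A\<close> unfolding fg_subsemigroup_def by blast
    have A: "subsemigroup A" using subsemigroup_hull X by simp
    have "inverse_of x \<in> A" if "x \<in> A" for x
    proof -
      have "subsemigroup hull {x} \<subseteq> A" using A that by (intro hull_minimal) auto
      then show ?thesis using inv A that unfolding subsemigroup_def by blast
    qed
    \<comment> \<open>Adjoining the inverses of the generators does not enlarge \<open>A\<close>, so
      \<open>A\<close> is also the inverse subsemigroup generated by \<open>X\<close>.\<close>
    then have "inverse_of ` X \<subseteq> A"
      using hull_subset[of X subsemigroup] X(3) by auto
    then have "subsemigroup hull (X \<union> inverse_of ` X) = A"
      using A X(3) hull_subset[of X subsemigroup] hull_mono[of X "X \<union> inverse_of ` X" subsemigroup]
      by (intro equalityI hull_minimal) auto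
    then show ?thesis
      using inverse_hull_eq_hull[OF X(2)] X unfolding fg_inverse_subsemigroup_def by metis
  qed
  then show ?thesis using assms(1) unfolding HS_def HIS_def by blast
qed

end

theorem lemma6p1:
  fixes S :: "'a set" and mult :: "'a \<Rightarrow> 'a \<Rightarrow> 'a"
  assumes "inverse_semigroup S mult"
    and "countable S"
    and "inverse_semigroup.periodic S mult"
  shows "inverse_semigroup.HS S mult \<longleftrightarrow> inverse_semigroup.HIS S mult"
  using assms inverse_semigroup.HS_imp_HIS inverse_semigroup.HIS_periodic_imp_HS by blast

end
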